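(* Let $n = p^2$ with $p$ a prime number. Then $p$ is a Wieferich prime if and only if $n$ is a solution of the congruence $$\binom{2n}{n} \equiv 2^n \pmod n.$$
   Context: A Wieferich prime is a prime number $p$ such that $p^2$ divides $2^{p-1} - 1$. *)

theory Defs
  imports "HOL-Number_Theory.Number_Theory"
begin

definition wieferich_prime :: "nat \<Rightarrow> bool" where
  "wieferich_prime p \<longleftrightarrow> prime p \<and> p\<^sup>2 dvd 2 ^ (p - 1) - 1"

end

theory Submission
  imports Defs
begin

text \<open>
  By Vandermonde, the central binomial coefficient of \<open>n = p\<^sup>2\<close> is the sum of the squares of the
  binomial coefficients of \<open>p\<^sup>2\<close>. Apart from the two outer ones these are divisible by \<open>p\<close>, so the
  sum is 2 modulo \<open>p\<^sup>2\<close>. On the other side, Euler's theorem for the modulus \<open>p\<^sup>2\<close> reduces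
  \<open>2 ^ p\<^sup>2\<close> to \<open>2 ^ p\<close>, and cancelling a factor 2 leaves the Wieferich condition.
\<close>

text \<open>By absorption, \<open>k\<close> times the coefficient is a multiple of
  \<open>p ^ a\<close>. Were the coefficient prime to \<open>p\<close>, all of \<open>p ^ a\<close>
  would have to divide the smaller positive number \<open>k\<close>.\<close>

lemma prime_dvd_prime_power_choose:
  fixes p a k :: nat
  assumes "prime p" and "0 < k" and "k < p ^ a"
  shows "p dvd (p ^ a) choose k"
proof (rule ccontr)
  assume "\<not> p dvd (p ^ a) choose k"
  then have "coprime (p ^ a) ((p ^ a) choose k)"
    using assms(1) by (simp add: prime_imp_coprime)
  moreover have "p ^ a dvd k * ((p ^ a) choose k)"
    using times_binomial_minus1_eq[OF assms(2), of "p ^ a"] by simp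
  ultimately have "p ^ a dvd k"
    by (simp add: coprime_dvd_mult_left_iff)
  with assms(2,3) show False
    by (auto dest: dvd_imp_le)
qed

lemma central_binomial_prime_power_cong:
  fixes p a :: nat
  assumes "prime p"
  shows "[(2 * p ^ a) choose (p ^ a) = 2] (mod p\<^sup>2)"
proof -
  let ?n = "p ^ a"
  have n: "?n > 0"
    using assms by (simp add: prime_gt_0_nat)
  have split: "{..?n} = insert 0 (insert ?n {0<..<?n})"
    using n by auto
  have "(2 * ?n) choose ?n = 2 + (\<Sum>k\<in>{0<..<?n}. (?n choose k)\<^sup>2)"
    unfolding choose_square_sum[symmetric] split using n by simp
  moreover have "p\<^sup>2 dvd (\<Sum>k\<in>{0<..<?n}. (?n choose k)\<^sup>2)"
    using assms by (auto intro!: dvd_sum dvd_power_same prime_dvd_prime_power_choose)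
  ultimately show ?thesis
    by (simp only: cong_add_lcancel_0_nat cong_0_iff)
qed

text \<open>The exponent \<open>p\<^sup>2\<close> exceeds the totient \<open>p * (p - 1)\<close> of
  the modulus by exactly \<open>p\<close>.\<close>

lemma cong_power_prime_square:
  fixes p a :: nat
  assumes "prime p" and "coprime a p"
  shows "[a ^ p\<^sup>2 = a ^ p] (mod p\<^sup>2)"
proof -
  have "totient (p\<^sup>2) = p * (p - 1)"
    using totient_prime_power[OF assms(1), of 2] by simp
  then have "[a ^ (p * (p - 1)) = 1] (mod p\<^sup>2)"
    using euler_theorem[of a "p\<^sup>2"] assms(2) by simp
  then have "[a ^ (p * (p - 1)) * a ^ p = 1 * a ^ p] (mod p\<^sup>2)"
    by (rule cong_mult) simp
  moreover have "p * (p - 1) + p = p\<^sup>2"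
    using prime_gt_0_nat[OF assms(1)] by (simp add: power2_eq_square diff_mult_distrib2)
  ultimately show ?thesis
    by (simp flip: power_add)
qed

theorem theorem3p2:
  fixes n p :: nat
  assumes "prime p" and "n = p\<^sup>2"
  shows "wieferich_prime p \<longleftrightarrow> [(2 * n) choose n = 2 ^ n] (mod n)"
proof -
  have "[(2 * n) choose n = 2 ^ n] (mod n) \<longleftrightarrow> [2 = 2 ^ n] (mod n)"
    using central_binomial_prime_power_cong[OF assms(1), of 2] assms(2)
    by (auto simp: cong_def)
  also have "\<dots> \<longleftrightarrow> wieferich_prime p"
  proof (cases "p = 2")
    \<comment> \<open>Here 2 is not invertible modulo \<open>n = 4\<close>, but both sides are
      false: 4 does not divide 1, and 2 is not congruent to 16.\<close>
    case True
    then show ?thesis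
      using assms(2) by (simp add: wieferich_prime_def cong_def)
  next
    case False
    then have cop: "coprime 2 p"
      using assms(1) primes_coprime two_is_prime_nat by metis
    have "2 * 2 ^ (p - 1) = (2::nat) ^ p"
      using prime_gt_0_nat[OF assms(1)] by (simp add: power_eq_if)
    then have "[2 = 2 ^ n] (mod n) \<longleftrightarrow> [2 * 1 = 2 * 2 ^ (p - 1)] (mod n)"
      using cong_power_prime_square[OF assms(1) cop] assms(2) by (auto simp: cong_def)
    also have "\<dots> \<longleftrightarrow> [1 = 2 ^ (p - 1)] (mod n)"
      using cop assms(2) by (intro cong_mult_lcancel_nat) simp
    \<comment> \<open>The congruence is flipped so that the truncated subtraction takes the smaller
      number, 1, from the larger.\<close>
    also have "\<dots> \<longleftrightarrow> n dvd 2 ^ (p - 1) - 1"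
      by (subst cong_sym_eq, rule cong_altdef_nat) simp
    finally show ?thesis
      using assms by (simp add: wieferich_prime_def)
  qed
  finally show ?thesis ..
qed

end
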